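(* For any integer $n$, set $T(n)=\frac{n^2-3n}{2}-\left\lceil\frac{n}{2}\right\rceil+2$. For every integer $n\ge 8$ there exists a finite simple graph with $n$ vertices and exactly $T(n)$ edges that has an edge $xy$ with $\kappa_{LLY}(x,y)\le 0$ (so the edge threshold $T(n)$ for positive curvature is optimal). Moreover, for $n=8$, for $n=10$, and for every odd $n\ge 9$, such a graph is not unique: there exist at least two non-isomorphic finite simple graphs with $n$ vertices and exactly $T(n)$ edges each having an edge of non-positive Lin--Lu--Yau curvature.
   Context: Graphs are finite and simple; $\rho$ is the graph distance and $d_x$ the degree of $x$. For a vertex $x$ with $d_x\ge 1$ and $p\in[0,1]$, $\mu_x^p$ is the probability measure on $V$ with $\mu_x^p(x)=p$, $\mu_x^p(z)=\frac{1-p}{d_x}$ if $xz\in E$, and $\mu_x^p(z)=0$ otherwise. For probability measures $\mu_1,\mu_2$ on $V$, $W(\mu_1,\mu_2)=\inf_\pi\sum_{u,v\in V}\rho(u,v)\pi(u,v)$, the infimum being over all $\pi:V\times V\to[0,1]$ with $\sum_{v}\pi(u,v)=\mu_1(u)$ for all $u$ and $\sum_u\pi(u,v)=\mu_2(v)$ for all $v$. For an edge $xy$, $\kappa_p(x,y)=1-W(\mu_x^p,\mu_y^p)$ and the Lin--Lu--Yau curvature is $\kappa_{LLY}(x,y)=\lim_{p\to1}\frac{\kappa_p(x,y)}{1-p}$ (this limit exists). *)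

theory Defs
  imports "HOL-Analysis.Analysis"
begin

definition simple_graph :: "'a set \<Rightarrow> 'a set set \<Rightarrow> bool" where
  "simple_graph V E \<longleftrightarrow> finite V \<and> (\<forall>e\<in>E. e \<subseteq> V \<and> card e = 2)"

definition graph_iso :: "'a set \<Rightarrow> 'a set set \<Rightarrow> 'b set \<Rightarrow> 'b set set \<Rightarrow> bool" where
  "graph_iso V E V' E' \<longleftrightarrow>
     (\<exists>f. bij_betw f V V' \<and> (\<forall>u\<in>V. \<forall>v\<in>V. {u, v} \<in> E \<longleftrightarrow> {f u, f v} \<in> E'))"

definition degree :: "'a set set \<Rightarrow> 'a \<Rightarrow> nat" where
  "degree E x = card {z. {x, z} \<in> E}"

definition adj_rel :: "'a set set \<Rightarrow> ('a \<times> 'a) set" where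
  "adj_rel E = {(u, v). {u, v} \<in> E}"

(* The pair (u, v) lies in the k-th relational power iff there is a walk of length k from u to v.
   For vertices in different components the value 0 is a dummy: the measures compared below are
   supported on the closed neighbourhoods of two adjacent vertices, so every coupling of them
   vanishes on such pairs. *)
definition graph_dist :: "'a set set \<Rightarrow> 'a \<Rightarrow> 'a \<Rightarrow> nat" where
  "graph_dist E u v =
     (if (u, v) \<in> (adj_rel E)\<^sup>* then (LEAST k. (u, v) \<in> adj_rel E ^^ k) else 0)"

definition lazy_measure :: "'a set set \<Rightarrow> real \<Rightarrow> 'a \<Rightarrow> 'a \<Rightarrow> real" where
  "lazy_measure E p x z =
     (if z = x then p else if {x, z} \<in> E then (1 - p) / real (degree E x) else 0)"

definition couplings :: "'a set \<Rightarrow> ('a \<Rightarrow> real) \<Rightarrow> ('a \<Rightarrow> real) \<Rightarrow> ('a \<Rightarrow> 'a \<Rightarrow> real) set" where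
  "couplings V \<mu> \<nu> =
     {\<pi>. (\<forall>u\<in>V. \<forall>v\<in>V. 0 \<le> \<pi> u v \<and> \<pi> u v \<le> 1) \<and>
          (\<forall>u\<in>V. (\<Sum>v\<in>V. \<pi> u v) = \<mu> u) \<and>
          (\<forall>v\<in>V. (\<Sum>u\<in>V. \<pi> u v) = \<nu> v)}"

definition wasserstein :: "'a set \<Rightarrow> 'a set set \<Rightarrow> ('a \<Rightarrow> real) \<Rightarrow> ('a \<Rightarrow> real) \<Rightarrow> real" where
  "wasserstein V E \<mu> \<nu> =
     (INF \<pi>\<in>couplings V \<mu> \<nu>. \<Sum>u\<in>V. \<Sum>v\<in>V. real (graph_dist E u v) * \<pi> u v)"

definition kappa :: "'a set \<Rightarrow> 'a set set \<Rightarrow> real \<Rightarrow> 'a \<Rightarrow> 'a \<Rightarrow> real" where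
  "kappa V E p x y = 1 - wasserstein V E (lazy_measure E p x) (lazy_measure E p y)"

(* Since p ranges over [0, 1], the limit is the one-sided limit from the left. *)
definition kappa_LLY :: "'a set \<Rightarrow> 'a set set \<Rightarrow> 'a \<Rightarrow> 'a \<Rightarrow> real" where
  "kappa_LLY V E x y = Lim (at_left 1) (\<lambda>p. kappa V E p x y / (1 - p))"

definition has_nonpos_edge :: "'a set \<Rightarrow> 'a set set \<Rightarrow> bool" where
  "has_nonpos_edge V E \<longleftrightarrow> (\<exists>x y. {x, y} \<in> E \<and> kappa_LLY V E x y \<le> 0)"

definition edge_threshold :: "int \<Rightarrow> real" where
  "edge_threshold n =
     ((real_of_int n)\<^sup>2 - 3 * real_of_int n) / 2 - real_of_int \<lceil>real_of_int n / 2\<rceil> + 2"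

end

theory Submission
  imports Defs
begin

text \<open>
  The quotient \<open>\<kappa>\<^sub>p(x,y) / (1 - p)\<close> is nondecreasing in \<open>p\<close>, so once \<open>\<kappa>\<^sub>p(x,y) \<le> 0\<close> for all
  \<open>p < 1\<close> the limit exists and is nonpositive. By the easy half of Kantorovich duality this
  holds as soon as some 1-Lipschitz \<open>f\<close> drops by 1 from \<open>x\<close> to \<open>y\<close> and its mean drops by at least 1
  from the neighbourhood of \<open>x\<close> to that of \<open>y\<close>.

  All examples consist of a clique on \<open>n - 2\<close> vertices containing \<open>y\<close>, two further adjacent
  vertices \<open>x\<close> and \<open>s\<close>, and edges from \<open>x\<close> to a set \<open>A \<ni> y\<close> and from \<open>s\<close> to a set \<open>S\<close> in the
  clique. The function \<open>f\<close> is 1 at \<open>x\<close>, 0 on \<open>A \<union> S\<close>, -1 on the rest of the clique, and 1 at \<open>s\<close>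
  (or 2 if \<open>S\<close> is empty). With \<open>|A| + |S| = n - 2 - \<lceil>n/2\<rceil>\<close> there are \<open>T(n)\<close> edges; about half of
  the neighbours of \<open>y\<close> then have \<open>f = -1\<close>.
\<close>

section \<open>Graph distance and 1-Lipschitz functions\<close>

lemma simple_graph_edge:
  assumes "simple_graph V E" "{u, v} \<in> E"
  shows "u \<in> V" "v \<in> V" "u \<noteq> v"
proof -
  have "{u, v} \<subseteq> V" "card {u, v} = 2"
    using assms by (auto simp: simple_graph_def)
  then show "u \<in> V" "v \<in> V" "u \<noteq> v" by auto
qed

lemma graph_dist_edge_le:
  assumes "{x, y} \<in> E"
  shows "graph_dist E x y \<le> 1"
proof -
  have "(x, y) \<in> adj_rel E ^^ 1" using assms by (simp add: adj_rel_def)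
  then have "(LEAST k. (x, y) \<in> adj_rel E ^^ k) \<le> 1" by (rule Least_le)
  then show ?thesis by (simp add: graph_dist_def)
qed

text \<open>Along a walk of length k the differences over its edges telescope to at most k.
  Reachability makes the distance the length of an actual walk instead of the dummy 0.\<close>

lemma diff_le_graph_dist:
  fixes f :: "'a \<Rightarrow> real"
  assumes edge: "\<And>u v. {u, v} \<in> E \<Longrightarrow> f u - f v \<le> 1"
    and reach: "(u, v) \<in> (adj_rel E)\<^sup>*"
  shows "f u - f v \<le> real (graph_dist E u v)"
proof -
  have walk: "f u - f w \<le> real k" if "(u, w) \<in> adj_rel E ^^ k" for k w
    using that
  proof (induction k arbitrary: w)
    case (Suc k)
    then obtain z where "(u, z) \<in> adj_rel E ^^ k" "{z, w} \<in> E"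
      by (auto simp: adj_rel_def)
    with Suc.IH edge[of z w] show ?case by fastforce
  qed simp
  obtain k where "(u, v) \<in> adj_rel E ^^ k" using reach rtrancl_imp_relpow by metis
  then have "(u, v) \<in> adj_rel E ^^ (LEAST k. (u, v) \<in> adj_rel E ^^ k)" by (rule LeastI)
  from walk[OF this] show ?thesis using reach by (simp add: graph_dist_def)
qed

section \<open>Couplings and weak Kantorovich duality\<close>

definition transport_cost :: "'a set \<Rightarrow> 'a set set \<Rightarrow> ('a \<Rightarrow> 'a \<Rightarrow> real) \<Rightarrow> real" where
  "transport_cost V E \<pi> = (\<Sum>u\<in>V. \<Sum>v\<in>V. real (graph_dist E u v) * \<pi> u v)"

text \<open>A real \<open>INF\<close> lies below its members only if the family is bounded below;
  here distances and couplings are nonnegative, so 0 is a bound.\<close>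

lemma wasserstein_le_cost:
  assumes "\<pi> \<in> couplings V \<mu> \<nu>"
  shows "wasserstein V E \<mu> \<nu> \<le> transport_cost V E \<pi>"
proof -
  have "bdd_below (transport_cost V E ` couplings V \<mu> \<nu>)"
    by (rule bdd_belowI2[where m = 0])
      (auto simp: transport_cost_def couplings_def intro!: sum_nonneg)
  then show ?thesis
    using assms cINF_lower unfolding wasserstein_def transport_cost_def by fastforce
qed

text \<open>The product measure is a coupling. This keeps the real infimum from ranging over the
  empty set.\<close>

lemma couplings_nonempty:
  assumes "\<And>u. u \<in> V \<Longrightarrow> 0 \<le> \<mu> u" "\<And>u. u \<in> V \<Longrightarrow> 0 \<le> \<nu> u"
    and "sum \<mu> V = 1" "sum \<nu> V = 1" "finite V"
  shows "couplings V \<mu> \<nu> \<noteq> {}"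
proof -
  have "\<mu> u \<le> 1" "\<nu> u \<le> 1" if "u \<in> V" for u
    using member_le_sum[of u V \<mu>] member_le_sum[of u V \<nu>] assms that by auto
  then have "(\<lambda>u v. \<mu> u * \<nu> v) \<in> couplings V \<mu> \<nu>"
    using assms
    by (auto simp: couplings_def mult_le_one sum_distrib_left[symmetric] sum_distrib_right[symmetric])
  then show ?thesis by blast
qed

lemma wasserstein_ge:
  assumes ne: "couplings V \<mu> \<nu> \<noteq> {}"
    and lower: "\<And>\<pi>. \<pi> \<in> couplings V \<mu> \<nu> \<Longrightarrow> c \<le> transport_cost V E \<pi>"
  shows "c \<le> wasserstein V E \<mu> \<nu>"
  unfolding wasserstein_def
  by (rule cINF_greatest[OF ne]) (use lower in \<open>simp add: transport_cost_def\<close>)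

text \<open>Writing both measures as marginals of \<open>\<pi>\<close> turns the difference of means
  into the sum of \<open>(f u - f v) * \<pi> u v\<close>, which the cost dominates term by
  term.\<close>

lemma kantorovich_lower_bound:
  fixes f :: "'a \<Rightarrow> real"
  assumes \<pi>: "\<pi> \<in> couplings V \<mu> \<nu>"
    and lip: "\<And>u v. u \<in> V \<Longrightarrow> v \<in> V \<Longrightarrow> f u - f v \<le> real (graph_dist E u v)"
  shows "(\<Sum>u\<in>V. f u * \<mu> u) - (\<Sum>v\<in>V. f v * \<nu> v) \<le> transport_cost V E \<pi>"
proof -
  have "(\<Sum>u\<in>V. f u * \<mu> u) - (\<Sum>v\<in>V. f v * \<nu> v)
      = (\<Sum>u\<in>V. f u * (\<Sum>v\<in>V. \<pi> u v)) - (\<Sum>v\<in>V. f v * (\<Sum>u\<in>V. \<pi> u v))"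
    using \<pi> by (simp add: couplings_def)
  also have "\<dots> = (\<Sum>u\<in>V. \<Sum>v\<in>V. f u * \<pi> u v) - (\<Sum>v\<in>V. \<Sum>u\<in>V. f v * \<pi> u v)"
    by (simp add: sum_distrib_left)
  also have "(\<Sum>v\<in>V. \<Sum>u\<in>V. f v * \<pi> u v) = (\<Sum>u\<in>V. \<Sum>v\<in>V. f v * \<pi> u v)"
    by (rule sum.swap)
  also have "(\<Sum>u\<in>V. \<Sum>v\<in>V. f u * \<pi> u v) - \<dots> = (\<Sum>u\<in>V. \<Sum>v\<in>V. (f u - f v) * \<pi> u v)"
    by (simp add: sum_subtractf left_diff_distrib)
  also have "\<dots> \<le> transport_cost V E \<pi>"
    unfolding transport_cost_def using \<pi> lip
    by (intro sum_mono mult_right_mono) (auto simp: couplings_def)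
  finally show ?thesis .
qed

section \<open>Lazy measures, the curvature quotient and its limit\<close>

lemma sum_lazy_measure:
  fixes g :: "'a \<Rightarrow> real"
  assumes G: "simple_graph V E" and x: "x \<in> V"
  shows "(\<Sum>z\<in>V. g z * lazy_measure E p x z)
     = p * g x + (1 - p) / real (degree E x) * (\<Sum>z | {x, z} \<in> E. g z)"
proof -
  have fin: "finite V" using G by (simp add: simple_graph_def)
  \<comment> \<open>There are no loops, so splitting off the summand at \<open>x\<close> loses no
    neighbour.\<close>
  have N: "{z. {x, z} \<in> E} = {z \<in> V - {x}. {x, z} \<in> E}"
    using simple_graph_edge[OF G] by blast
  have "(\<Sum>z\<in>V. g z * lazy_measure E p x z)
      = g x * p + (\<Sum>z\<in>V - {x}. g z * lazy_measure E p x z)"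
    using fin x by (simp add: sum.remove lazy_measure_def)
  also have "(\<Sum>z\<in>V - {x}. g z * lazy_measure E p x z)
      = (\<Sum>z\<in>V - {x}. if {x, z} \<in> E then (1 - p) / real (degree E x) * g z else 0)"
    by (rule sum.cong) (auto simp: lazy_measure_def)
  also have "\<dots> = (\<Sum>z\<in>{z \<in> V - {x}. {x, z} \<in> E}. (1 - p) / real (degree E x) * g z)"
    using fin by (intro sum.inter_filter[symmetric]) simp
  also have "\<dots> = (1 - p) / real (degree E x) * (\<Sum>z | {x, z} \<in> E. g z)"
    by (simp only: N sum_distrib_left)
  finally show ?thesis by simp
qed

lemma degree_pos:
  assumes "simple_graph V E" "{x, y} \<in> E"
  shows "degree E x > 0"
proof -
  have "{z. {x, z} \<in> E} \<subseteq> V" "finite V"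
    using assms(1) simple_graph_edge[OF assms(1)] by (auto simp: simple_graph_def)
  then show ?thesis
    using assms(2) by (auto simp: degree_def card_gt_0_iff intro: finite_subset)
qed

lemma sum_lazy_measure_eq_1:
  assumes "simple_graph V E" "{x, y} \<in> E"
  shows "sum (lazy_measure E p x) V = 1"
  using sum_lazy_measure[of V E x "\<lambda>_. 1" p] degree_pos[OF assms] assms simple_graph_edge[OF assms]
  by (simp add: degree_def)

lemma lazy_couplings_nonempty:
  assumes "simple_graph V E" "{x, y} \<in> E" "0 \<le> p" "p \<le> 1"
  shows "couplings V (lazy_measure E p x) (lazy_measure E p y) \<noteq> {}"
proof (rule couplings_nonempty)
  show "sum (lazy_measure E p x) V = 1" "sum (lazy_measure E p y) V = 1"
    using sum_lazy_measure_eq_1[of V E x y] sum_lazy_measure_eq_1[of V E y x] assms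
    by (auto simp: insert_commute)
  show "finite V" using assms by (simp add: simple_graph_def)
qed (use assms in \<open>auto simp: lazy_measure_def\<close>)

text \<open>Mixing the laziness \<open>p\<close> measures with the point masses at \<open>x\<close> and \<open>y\<close> gives the
  laziness \<open>q\<close> measures, and mixing the couplings accordingly costs at most \<open>1\<close> per unit of
  point mass.\<close>

lemma kappa_ratio_mono:
  assumes G: "simple_graph V E" and e: "{x, y} \<in> E" and pq: "0 \<le> p" "p \<le> q" "q < 1"
  shows "kappa V E p x y / (1 - p) \<le> kappa V E q x y / (1 - q)"
proof -
  define s where "s = (1 - q) / (1 - p)"
  have s: "0 < s" "s \<le> 1" and sp: "s * (1 - p) = 1 - q"
    using pq by (auto simp: s_def)
  have fin: "finite V" and xy: "x \<in> V" "y \<in> V"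
    using G simple_graph_edge[OF G e] by (auto simp: simple_graph_def)
  define W where "W r = wasserstein V E (lazy_measure E r x) (lazy_measure E r y)" for r
  define \<delta> :: "'a \<Rightarrow> 'a \<Rightarrow> real" where "\<delta> a z = (if z = a then 1 else 0)" for a z
  have mix: "lazy_measure E q a z = s * lazy_measure E p a z + (1 - s) * \<delta> a z" for a z
    using sp by (auto simp: lazy_measure_def \<delta>_def algebra_simps)
  have sum_\<delta>: "(\<Sum>z\<in>V. g z * \<delta> a z) = g a" if "a \<in> V" for g :: "'a \<Rightarrow> real" and a
    using fin that by (simp add: \<delta>_def if_distrib[of "(*) _"] cong: if_cong)
  have sum_\<delta>1: "(\<Sum>z\<in>V. \<delta> a z) = 1" if "a \<in> V" for a
    using sum_\<delta>[OF that, of "\<lambda>_. 1"] by simp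
  \<comment> \<open>The target is \<open>W q \<le> s * W p + (1 - s)\<close>. Solved for
    \<open>W p\<close>, it can be checked on each coupling at laziness \<open>p\<close>
    separately.\<close>
  have "(W q - (1 - s)) / s \<le> W p"
    unfolding W_def
  proof (rule wasserstein_ge)
    show "couplings V (lazy_measure E p x) (lazy_measure E p y) \<noteq> {}"
      using lazy_couplings_nonempty[OF G e] pq by simp
    fix \<pi> assume \<pi>: "\<pi> \<in> couplings V (lazy_measure E p x) (lazy_measure E p y)"
    define \<pi>' where "\<pi>' u v = s * \<pi> u v + (1 - s) * (\<delta> x u * \<delta> y v)" for u v
    have "\<pi>' u v \<le> 1" if "u \<in> V" "v \<in> V" for u v
    proof -
      have "\<pi>' u v \<le> s * 1 + (1 - s) * 1"
        unfolding \<pi>'_def using \<pi> s that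
        by (intro add_mono mult_left_mono) (auto simp: couplings_def \<delta>_def)
      then show ?thesis by simp
    qed
    moreover have "0 \<le> \<pi>' u v" if "u \<in> V" "v \<in> V" for u v
      using \<pi> s that by (auto simp: \<pi>'_def couplings_def \<delta>_def)
    moreover have "(\<Sum>v\<in>V. \<pi>' u v) = lazy_measure E q x u" if "u \<in> V" for u
    proof -
      have "(\<Sum>v\<in>V. \<pi>' u v) = s * (\<Sum>v\<in>V. \<pi> u v) + (1 - s) * (\<delta> x u * (\<Sum>v\<in>V. \<delta> y v))"
        by (simp add: \<pi>'_def sum.distrib sum_distrib_left)
      then show ?thesis
        using \<pi> that xy by (simp add: sum_\<delta>1 mix couplings_def)
    qed
    moreover have "(\<Sum>u\<in>V. \<pi>' u v) = lazy_measure E q y v" if "v \<in> V" for v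
    proof -
      have "(\<Sum>u\<in>V. \<pi>' u v) = s * (\<Sum>u\<in>V. \<pi> u v) + (1 - s) * ((\<Sum>u\<in>V. \<delta> x u) * \<delta> y v)"
        by (simp add: \<pi>'_def sum.distrib sum_distrib_left sum_distrib_right)
      then show ?thesis
        using \<pi> that xy by (simp add: sum_\<delta>1 mix couplings_def)
    qed
    ultimately have "\<pi>' \<in> couplings V (lazy_measure E q x) (lazy_measure E q y)"
      by (simp add: couplings_def)
    then have "W q \<le> transport_cost V E \<pi>'"
      unfolding W_def by (rule wasserstein_le_cost)
    also have "transport_cost V E \<pi>' = s * transport_cost V E \<pi>
        + (1 - s) * (\<Sum>u\<in>V. (\<Sum>v\<in>V. real (graph_dist E u v) * \<delta> y v) * \<delta> x u)"
      by (simp add: transport_cost_def \<pi>'_def sum.distrib sum_distrib_left sum_distrib_right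
          distrib_left mult_ac)
    also have "\<dots> = s * transport_cost V E \<pi> + (1 - s) * real (graph_dist E x y)"
      using xy by (simp add: sum_\<delta>)
    also have "\<dots> \<le> s * transport_cost V E \<pi> + (1 - s) * 1"
      using s graph_dist_edge_le[OF e] by (intro add_left_mono mult_left_mono) auto
    finally show "(wasserstein V E (lazy_measure E q x) (lazy_measure E q y) - (1 - s)) / s
        \<le> transport_cost V E \<pi>"
      using s by (simp add: W_def field_simps)
  qed
  then have "s * (1 - W p) \<le> 1 - W q"
    using s by (simp add: field_simps)
  then have "(1 - q) * (1 - W p) / (1 - p) \<le> 1 - W q"
    by (simp add: s_def)
  then show ?thesis
    using pq by (simp add: kappa_def W_def[symmetric] field_simps)
qed

text \<open>\<open>Lim\<close> is a definite description, so bounding it requires convergence first.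
  The quotient is monotone and bounded above by 0, hence tends to its supremum.\<close>

lemma kappa_LLY_nonpos:
  assumes G: "simple_graph V E" and e: "{x, y} \<in> E"
    and nonpos: "\<And>p. 0 \<le> p \<Longrightarrow> p < 1 \<Longrightarrow> kappa V E p x y \<le> 0"
  shows "kappa_LLY V E x y \<le> 0"
proof -
  define g where "g p = kappa V E p x y / (1 - p)" for p
  have g: "g p \<le> 0" if "0 \<le> p" "p < 1" for p
    using nonpos that by (simp add: g_def divide_nonpos_nonneg)
  have "(g \<longlongrightarrow> Sup (g ` ({..<1} \<inter> {0<..}))) (at 1 within ({..<1} \<inter> {0<..}))"
    by (rule Lim_left_bound[where K = 0])
      (use g kappa_ratio_mono[OF G e] in \<open>auto simp: g_def\<close>)
  \<comment> \<open>Monotonicity is available only for nonnegative laziness; cutting down to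
    positive reals leaves the left filter at 1 unchanged.\<close>
  also have "at 1 within ({..<1} \<inter> {0<..}) = at_left (1::real)"
    by (rule at_within_nhd[where S = "{0<..}"]) auto
  finally obtain l where l: "(g \<longlongrightarrow> l) (at_left 1)" by blast
  have "eventually (\<lambda>p. p \<in> {0<..<1}) (at_left (1::real))"
    by (rule eventually_at_left_real) simp
  then have "eventually (\<lambda>p. g p \<le> 0) (at_left 1)"
    by eventually_elim (use g in auto)
  with l have "l \<le> 0"
    by (intro tendsto_upperbound) auto
  moreover have "kappa_LLY V E x y = l"
    using l unfolding kappa_LLY_def g_def[abs_def] by (intro tendsto_Lim) auto
  ultimately show ?thesis by simp
qed

text \<open>The mean of \<open>f\<close> drops by \<open>p * 1\<close> from the point masses and by
  at least \<open>(1 - p) * 1\<close> from the neighbourhoods, so duality gives Wasserstein distance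
  at least 1 for every \<open>p < 1\<close>.\<close>

lemma kappa_LLY_nonpos_if_potential:
  fixes f :: "'a \<Rightarrow> real"
  assumes G: "simple_graph V E" and e: "{x, y} \<in> E"
    and conn: "\<And>u v. u \<in> V \<Longrightarrow> v \<in> V \<Longrightarrow> (u, v) \<in> (adj_rel E)\<^sup>*"
    and lip: "\<And>u v. {u, v} \<in> E \<Longrightarrow> f u - f v \<le> 1"
    and drop: "f x - f y = 1"
    and avg: "(\<Sum>z | {x, z} \<in> E. f z) / real (degree E x)
              - (\<Sum>z | {y, z} \<in> E. f z) / real (degree E y) \<ge> 1"
  shows "kappa_LLY V E x y \<le> 0"
proof (rule kappa_LLY_nonpos[OF G e])
  fix p :: real assume p: "0 \<le> p" "p < 1"
  have xy: "x \<in> V" "y \<in> V" using simple_graph_edge[OF G e] by auto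
  let ?Ax = "(\<Sum>z | {x, z} \<in> E. f z) / real (degree E x)"
  let ?Ay = "(\<Sum>z | {y, z} \<in> E. f z) / real (degree E y)"
  have "1 = p * (f x - f y) + (1 - p) * 1" using drop by simp
  also have "\<dots> \<le> p * (f x - f y) + (1 - p) * (?Ax - ?Ay)"
    using avg p by (intro add_left_mono mult_left_mono) auto
  also have "\<dots> = (\<Sum>u\<in>V. f u * lazy_measure E p x u) - (\<Sum>v\<in>V. f v * lazy_measure E p y v)"
    unfolding sum_lazy_measure[OF G xy(1)] sum_lazy_measure[OF G xy(2)]
    by (simp add: algebra_simps)
  also have "\<dots> \<le> wasserstein V E (lazy_measure E p x) (lazy_measure E p y)"
    using lazy_couplings_nonempty[OF G e] p
    by (intro wasserstein_ge kantorovich_lower_bound diff_le_graph_dist lip conn) auto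
  finally show "kappa V E p x y \<le> 0" by (simp add: kappa_def)
qed

section \<open>Clique extensions: edges, edge count, connectivity, curvature\<close>

text \<open>Here \<open>x = 0\<close>, \<open>s = 1\<close> and \<open>y = 2\<close>.\<close>

definition clique_ext :: "nat \<Rightarrow> nat set \<Rightarrow> nat set \<Rightarrow> nat set set" where
  "clique_ext n A S =
     {e. e \<subseteq> {2..<n} \<and> card e = 2} \<union> {{0, 1}} \<union> (\<lambda>i. {0, i}) ` A \<union> (\<lambda>i. {1, i}) ` S"

locale clique_extension =
  fixes n :: nat and A S :: "nat set"
  assumes A: "A \<subseteq> {2..<n}" and S: "S \<subseteq> {2..<n}" and A2: "2 \<in> A"
begin

abbreviation "E \<equiv> clique_ext n A S"

lemma n_gt_2: "n > 2"
  using A A2 by auto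

lemma finite_AS [simp]: "finite A" "finite S"
  using A S finite_subset by blast+

lemma edge_0: "{0, i} \<in> E \<longleftrightarrow> i = 1 \<or> i \<in> A"
  using A S by (force simp: clique_ext_def doubleton_eq_iff)

lemma edge_1: "{Suc 0, i} \<in> E \<longleftrightarrow> i = 0 \<or> i \<in> S"
  using A S by (force simp: clique_ext_def doubleton_eq_iff)

lemma edge_clique:
  assumes "i \<ge> 2"
  shows "{i, j} \<in> E \<longleftrightarrow> j = 0 \<and> i \<in> A \<or> j = 1 \<and> i \<in> S \<or> 2 \<le> j \<and> i < n \<and> j < n \<and> i \<noteq> j"
proof -
  consider "j = 0" | "j = 1" | "j \<ge> 2" by linarith
  then show ?thesis
  proof cases
    case 1 then show ?thesis using assms edge_0[of i] by (simp add: insert_commute)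
  next
    case 2 then show ?thesis using assms edge_1[of i] by (simp add: insert_commute)
  next
    case 3
    then have "0 \<notin> {i, j}" "1 \<notin> {i, j}" using assms by auto
    then have "{i, j} \<noteq> {0, 1}" "{i, j} \<notin> (\<lambda>k. {0, k}) ` A" "{i, j} \<notin> (\<lambda>k. {1, k}) ` S"
      by (metis insertI1, metis imageE insertI1, metis imageE insertI1)
    then have "{i, j} \<in> E \<longleftrightarrow> {i, j} \<subseteq> {2..<n} \<and> card {i, j} = 2"
      by (simp add: clique_ext_def)
    then show ?thesis using 3 assms by (auto simp: card_insert_if)
  qed
qed

lemma simple: "simple_graph {..<n} E"
  using A S n_gt_2 by (force simp: simple_graph_def clique_ext_def card_insert_if)

lemma card_edges: "card E = ((n - 2) choose 2) + 1 + card A + card S"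
proof -
  define K where "K = {e. e \<subseteq> {2..<n} \<and> card e = 2}"
  define EA where "EA = (\<lambda>i. {0, i}) ` A"
  define ES where "ES = (\<lambda>i. {1, i}) ` S"
  have fin: "finite K" "finite EA" "finite ES"
    unfolding K_def EA_def ES_def by (auto intro: finite_subset[of _ "Pow {2..<n}"])
  have K: "card K = (n - 2) choose 2"
    using n_subsets[of "{2..<n}" 2] by (simp add: K_def)
  have EA: "card EA = card A"
    using A unfolding EA_def by (intro card_image) (auto simp: inj_on_def doubleton_eq_iff)
  have ES: "card ES = card S"
    using S unfolding ES_def by (intro card_image) (auto simp: inj_on_def doubleton_eq_iff)
  \<comment> \<open>Which of 0 and 1 an edge contains tells the four kinds of edges apart, so their
    cardinalities add up.\<close>
  have in_K: "0 \<notin> e \<and> 1 \<notin> e" if "e \<in> K" for e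
    using that by (auto simp: K_def)
  have in_EA: "0 \<in> e \<and> 1 \<notin> e" if e: "e \<in> EA" for e
  proof -
    obtain i where "i \<in> A" "e = {0, i}" using e unfolding EA_def by blast
    moreover have "i \<ge> 2" using \<open>i \<in> A\<close> A by auto
    ultimately show ?thesis by simp
  qed
  have in_ES: "0 \<notin> e \<and> 1 \<in> e" if e: "e \<in> ES" for e
  proof -
    obtain i where "i \<in> S" "e = {1, i}" using e unfolding ES_def by blast
    moreover have "i \<ge> 2" using \<open>i \<in> S\<close> S by auto
    ultimately show ?thesis by simp
  qed
  have "{0, 1} \<notin> K" "{0, 1} \<notin> EA" "{0, 1} \<notin> ES"
    using in_K[of "{0, 1}"] in_EA[of "{0, 1}"] in_ES[of "{0, 1}"] by auto
  moreover have "K \<inter> EA = {}" using in_K in_EA by (metis disjoint_iff)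
  moreover have "(K \<union> EA) \<inter> ES = {}" using in_K in_EA in_ES by (metis disjoint_iff Un_iff)
  moreover have "E = insert {0, 1} (K \<union> EA \<union> ES)"
    unfolding clique_ext_def K_def EA_def ES_def by simp
  ultimately show ?thesis
    using fin by (simp add: card_Un_disjoint K EA ES)
qed

text \<open>With h = ceil(n/2) this is the identity (n-2)(n-3)/2 + 1 + (n-2-h) = (n^2-3n)/2 - h +
  2.\<close>

lemma card_edges_eq_threshold:
  assumes "card A + card S + 2 + Suc n div 2 = n"
  shows "real (card E) = edge_threshold (int n)"
proof -
  define h where "h = Suc n div 2"
  have "\<lceil>real_of_int (int n) / 2\<rceil> = int h"
    by (rule ceiling_unique) (simp_all add: h_def field_simps)
  moreover have "real ((n - 2) choose 2) = (real n - 2) * (real n - 3) / 2"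
  proof -
    \<comment> \<open>The shift by 3 removes truncated subtraction from the binomial
      coefficient.\<close>
    obtain k where k: "n = k + 3" using n_gt_2 less_iff_Suc_add by fastforce
    have "real ((n - 2) choose 2) = real (Suc k * k div 2)"
      by (simp add: k choose_two)
    also have "\<dots> = real (Suc k * k) / 2" by (subst real_of_nat_div) auto
    finally show ?thesis by (simp add: k ring_distribs)
  qed
  moreover have "real (card A) + real (card S) = real n - 2 - real h"
    using assms by (simp add: h_def)
  ultimately show ?thesis
    by (simp add: card_edges edge_threshold_def power2_eq_square field_simps)
qed

text \<open>Vertex 2 is a hub: it is adjacent to 0 and to the rest of the clique, and 1 reaches it
  through 0.\<close>

lemma connected:
  assumes "u < n" "v < n"
  shows "(u, v) \<in> (adj_rel E)\<^sup>*"
proof -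
  have sym: "sym ((adj_rel E)\<^sup>*)"
    by (intro sym_rtrancl) (auto simp: sym_def adj_rel_def insert_commute)
  have to2: "(u, 2) \<in> (adj_rel E)\<^sup>*" if "u < n" for u
  proof -
    have 02: "(0, 2) \<in> (adj_rel E)\<^sup>*"
      using A2 by (auto simp: adj_rel_def edge_0)
    have "(1, 0) \<in> adj_rel E" by (simp add: adj_rel_def edge_1)
    then have 12: "(1, 2) \<in> (adj_rel E)\<^sup>*" using 02 by (rule converse_rtrancl_into_rtrancl)
    have "(u, 2) \<in> adj_rel E" if "u > 2" using that \<open>u < n\<close> by (simp add: adj_rel_def edge_clique)
    moreover consider "u = 0" | "u = 1" | "u = 2" | "u > 2" by linarith
    ultimately show ?thesis using 02 12 by cases auto
  qed
  then show ?thesis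
    using assms to2[of v] symD[OF sym] by (meson rtrancl_trans)
qed

text \<open>In \<open>ineq\<close> the first summand is the mean of the potential over the
  neighbours of 0, the second is minus its mean over the neighbours of 2. Here \<open>c\<close> is
  the potential at 1; the value 2 is possible only when 0, with potential 1, is the sole neighbour
  of 1.\<close>

lemma nonpos_edge:
  fixes c :: real
  assumes c: "c = 1 \<or> c = 2 \<and> S = {}"
    and ineq: "c / (1 + real (card A))
      + (real n - 3 - real (card (A \<union> S)) - of_bool (2 \<in> S)) / (real n - 2 + of_bool (2 \<in> S)) \<ge> 1"
  shows "has_nonpos_edge {..<n} E"
proof -
  define f where
    "f u = (if u = 0 then 1 else if u = 1 then c else if u \<in> A \<union> S then 0 else - 1 :: real)"
    for u :: nat
  define s :: real where "s = of_bool (2 \<in> S)"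
  have f_A: "f u = 0" if "u \<in> A" for u
    using that A by (auto simp: f_def)
  have N0: "{z. {0, z} \<in> E} = insert 1 A" by (auto simp: edge_0)
  have "1 \<notin> A" "0 \<notin> A" "1 \<notin> S" "0 \<notin> S" using A S by auto
  then have deg0: "degree E 0 = Suc (card A)" and sum0: "(\<Sum>z | {0, z} \<in> E. f z) = c"
    using f_A by (auto simp: degree_def N0 f_def[of "Suc 0"])
  have N2: "{z. {2, z} \<in> E} = insert 0 ({z. z = 1 \<and> 2 \<in> S} \<union> {3..<n})"
    using A2 n_gt_2 by (auto simp: edge_clique)
  have deg2: "real (degree E 2) = real n - 2 + s"
    using n_gt_2 by (auto simp: degree_def N2 s_def)
  \<comment> \<open>Vertex 2 lies in \<open>A\<close> and has potential 0, so it may join the sum,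
    which then runs over the whole clique.\<close>
  have "(\<Sum>z\<in>{3..<n}. f z) = (\<Sum>z\<in>{2..<n}. f z)"
    using n_gt_2 f_A[OF A2] by (simp add: sum.atLeast_Suc_lessThan numeral_3_eq_3 numeral_2_eq_2)
  also have "\<dots> = (\<Sum>z\<in>{2..<n} - (A \<union> S). f z) + (\<Sum>z\<in>A \<union> S. f z)"
    using A S by (intro sum.subset_diff) auto
  also have "(\<Sum>z\<in>A \<union> S. f z) = 0"
    using A S by (intro sum.neutral) (auto simp: f_def)
  also have "(\<Sum>z\<in>{2..<n} - (A \<union> S). f z) = (\<Sum>z\<in>{2..<n} - (A \<union> S). - 1)"
    by (rule sum.cong) (auto simp: f_def)
  also have "\<dots> = - (real n - 2 - real (card (A \<union> S)))"
    using A S n_gt_2 card_mono[of "{2..<n}" "A \<union> S"] by (simp add: card_Diff_subset of_nat_diff)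
  finally have sumK: "(\<Sum>z\<in>{3..<n}. f z) = - (real n - 2 - real (card (A \<union> S)))" by simp
  \<comment> \<open>If \<open>2 \<in> S\<close> then \<open>S\<close> is nonempty and
    \<open>c = 1\<close>, so vertex 1 contributes exactly \<open>s\<close>.\<close>
  have "(\<Sum>z | {2, z} \<in> E. f z) = 1 + s - (real n - 2 - real (card (A \<union> S)))"
    unfolding N2 using sumK c by (cases "2 \<in> S") (auto simp: s_def f_def[of 0] f_def[of "Suc 0"])
  then have avg: "(\<Sum>z | {0, z} \<in> E. f z) / real (degree E 0)
      - (\<Sum>z | {2, z} \<in> E. f z) / real (degree E 2) \<ge> 1"
    using ineq unfolding sum0 deg0 deg2 s_def[symmetric] by (simp add: diff_divide_distrib add_divide_distrib)
  have lip: "f u - f v \<le> 1" if "{u, v} \<in> E" for u v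
  proof -
    have 0: "f v \<ge> f 0 - 1 \<and> f v \<le> f 0 + 1" if "{0, v} \<in> E" for v
      using that c f_A by (auto simp: edge_0 f_def[of 0] f_def[of "Suc 0"])
    have 1: "f v \<ge> f 1 - 1 \<and> f v \<le> f 1 + 1" if "{1, v} \<in> E" for v
      using that c S by (auto simp: edge_1 f_def)
    \<comment> \<open>Only edges at 0 or 1 matter: on the clique \<open>f\<close> takes just the
      values 0 and -1.\<close>
    consider "u = 0" | "u = 1" | "v = 0" | "v = 1" | "u \<ge> 2" "v \<ge> 2" by linarith
    then show ?thesis
    proof cases
      case 1 then show ?thesis using 0 that by fastforce
    next
      case 2 then show ?thesis using 1 that by fastforce
    next
      case 3 then show ?thesis using 0[of u] that by (simp add: insert_commute)
    next
      case 4 then show ?thesis using 1[of u] that by (simp add: insert_commute)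
    next
      case 5 then show ?thesis by (simp add: f_def)
    qed
  qed
  have e: "{0, 2} \<in> E" using A2 by (simp add: edge_0)
  have "kappa_LLY {..<n} E 0 2 \<le> 0"
    by (rule kappa_LLY_nonpos_if_potential[OF simple e, where f = f])
      (use connected lip avg f_A[OF A2] in \<open>auto simp: f_def[of 0]\<close>)
  then show ?thesis using e by (auto simp: has_nonpos_edge_def)
qed

end

section \<open>Three extremal examples\<close>

definition extremal_example :: "nat \<Rightarrow> nat set set \<Rightarrow> bool" where
  "extremal_example n E \<longleftrightarrow>
     simple_graph {..<n} E \<and> real (card E) = edge_threshold (int n) \<and> has_nonpos_edge {..<n} E"

lemma (in clique_extension) extremal_exampleI:
  fixes c :: real
  assumes "card A + card S + 2 + Suc n div 2 = n"
    and "c = 1 \<or> c = 2 \<and> S = {}"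
    and "c / (1 + real (card A))
      + (real n - 3 - real (card (A \<union> S)) - of_bool (2 \<in> S)) / (real n - 2 + of_bool (2 \<in> S)) \<ge> 1"
  shows "extremal_example n E"
  using simple card_edges_eq_threshold nonpos_edge assms by (simp add: extremal_example_def)

text \<open>\<open>Suc n div 2\<close> is \<open>\<lceil>n/2\<rceil>\<close>.\<close>

definition base_example :: "nat \<Rightarrow> nat set set" where
  "base_example n = clique_ext n {2} {3..<n - Suc n div 2}"

text \<open>Compared with \<open>base_example\<close>, the interval is shifted down by one: it keeps
  its size, but now \<open>s\<close> is adjacent to \<open>y\<close>.\<close>

definition dominated_example :: "nat \<Rightarrow> nat set set" where
  "dominated_example n = clique_ext n {2} {2..<n - Suc (Suc n div 2)}"

definition pendant_example :: "nat \<Rightarrow> nat set set" where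
  "pendant_example n = clique_ext n {2..<n - Suc n div 2} {}"

text \<open>With h = ceil(n/2) the inequality is 1/2 + (h-1)/(n-2) \<ge> 1, that is n \<le>
  2h.\<close>

lemma base_example_extremal:
  assumes "n \<ge> 8"
  shows "extremal_example n (base_example n)"
proof -
  define h where "h = Suc n div 2"
  have h: "n \<le> 2 * h" "h + 4 \<le> n" using assms by (auto simp: h_def)
  interpret clique_extension n "{2}" "{3..<n - h}"
    using assms by unfold_locales auto
  have "card (insert 2 {3..<n - h}) = n - h - 2"
    using h by simp
  then have "1 / (1 + real (card {2::nat})) + (real n - 3 - real (card ({2} \<union> {3..<n - h}))
      - of_bool (2 \<in> {3..<n - h})) / (real n - 2 + of_bool (2 \<in> {3..<n - h})) \<ge> 1"
    using h assms by (simp add: of_nat_diff field_simps)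
  moreover have "card {2::nat} + card {3..<n - h} + 2 + Suc n div 2 = n"
    using h by (simp flip: h_def)
  ultimately show ?thesis
    using extremal_exampleI[of 1] by (simp add: base_example_def h_def)
qed

text \<open>Now \<open>y\<close> has degree n-1 and the inequality is 1/2 + (h-1)/(n-1) \<ge> 1,
  that is n+1 \<le> 2h: an equality for odd n, false for even n.\<close>

lemma dominated_example_extremal:
  assumes "odd n" "n \<ge> 9"
  shows "extremal_example n (dominated_example n)"
proof -
  define h where "h = Suc n div 2"
  have h: "n + 1 = 2 * h" "h + 4 \<le> n" using assms by (auto simp: h_def)
  interpret clique_extension n "{2}" "{2..<n - Suc h}"
    using assms by unfold_locales auto
  have "{2} \<union> {2..<n - Suc h} = {2..<n - Suc h}" "2 \<in> {2..<n - Suc h}"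
    using h by auto
  moreover have "1 / (1 + real (card {2::nat})) + (real n - 3 - real (card {2..<n - Suc h}) - 1)
      / (real n - 2 + 1) \<ge> 1"
  proof -
    have "real n = 2 * real h - 1" using h by linarith
    then show ?thesis using h assms by (simp add: of_nat_diff field_simps)
  qed
  moreover have "card {2::nat} + card {2..<n - Suc h} + 2 + Suc n div 2 = n"
    using h by (simp flip: h_def)
  ultimately show ?thesis
    using extremal_exampleI[of 1] by (simp add: dominated_example_def h_def)
qed

text \<open>For n = 2h the inequality with \<open>c = 2\<close> is 2/(h-1) + 1/2 \<ge> 1, that is h
  \<le> 5, which admits 8 and 10.\<close>

lemma pendant_example_extremal:
  assumes "n = 8 \<or> n = 10"
  shows "extremal_example n (pendant_example n)"
proof -
  define h where "h = Suc n div 2"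
  interpret clique_extension n "{2..<n - h}" "{}"
    using assms by unfold_locales (auto simp: h_def)
  show ?thesis
    using extremal_exampleI[of 2] assms by (auto simp: pendant_example_def h_def)
qed

section \<open>Non-isomorphism of the examples\<close>

text \<open>Only the second graph has a vertex, namely \<open>y\<close>, adjacent to all others.\<close>

lemma base_dominated_not_iso:
  assumes "n \<ge> 9"
  shows "\<not> graph_iso {..<n} (base_example n) {..<n} (dominated_example n)"
proof
  define h where "h = Suc n div 2"
  have h: "h + 4 \<le> n" using assms by (auto simp: h_def)
  assume "graph_iso {..<n} (base_example n) {..<n} (dominated_example n)"
  then obtain f where f: "bij_betw f {..<n} {..<n}"
    and iso: "\<And>u v. u < n \<Longrightarrow> v < n \<Longrightarrow>
      {u, v} \<in> base_example n \<longleftrightarrow> {f u, f v} \<in> dominated_example n"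
    by (auto simp: graph_iso_def)
  interpret B: clique_extension n "{2}" "{3..<n - h}"
    using assms by unfold_locales auto
  interpret D: clique_extension n "{2}" "{2..<n - Suc h}"
    using assms by unfold_locales auto
  have "2 \<in> f ` {..<n}" using f assms by (simp add: bij_betw_def)
  then obtain a where a: "a < n" "f a = 2" by auto
  have "{a, v} \<in> base_example n" if "v < n" "v \<noteq> a" for v
  proof -
    have "f v \<noteq> 2" "f v < n"
      using f a that by (auto simp: bij_betw_def inj_on_def)
    then have "{2, f v} \<in> dominated_example n"
      using h by (auto simp: dominated_example_def D.edge_clique simp flip: h_def)
    then show ?thesis using iso a that by simp
  qed
  \<comment> \<open>In the first graph 0 misses 3, the vertices 1 and 2 miss each other, and every
    clique vertex from 3 on misses 0.\<close>
  moreover have "\<exists>v<n. v \<noteq> a \<and> {a, v} \<notin> base_example n"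
  proof -
    consider "a = 0" | "a = 1" | "a = 2" | "a \<ge> 3" by linarith
    then show ?thesis
    proof cases
      case 1 then show ?thesis
        using assms by (intro exI[of _ 3]) (simp add: base_example_def B.edge_0 flip: h_def)
    next
      case 2 then show ?thesis
        using assms by (intro exI[of _ 2]) (simp add: base_example_def B.edge_1 flip: h_def)
    next
      case 3 then show ?thesis
        using assms by (intro exI[of _ 1]) (simp add: base_example_def B.edge_clique flip: h_def)
    next
      case 4 then show ?thesis
        using assms by (intro exI[of _ 0]) (simp add: base_example_def B.edge_clique flip: h_def)
    qed
  qed
  ultimately show False by blast
qed

text \<open>Only the second graph has a vertex of degree 1, namely \<open>s\<close>.\<close>

lemma base_pendant_not_iso:
  assumes "n \<ge> 8"
  shows "\<not> graph_iso {..<n} (base_example n) {..<n} (pendant_example n)"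
proof
  define h where "h = Suc n div 2"
  have h: "h + 4 \<le> n" using assms by (auto simp: h_def)
  assume "graph_iso {..<n} (base_example n) {..<n} (pendant_example n)"
  then obtain f where f: "bij_betw f {..<n} {..<n}"
    and iso: "\<And>u v. u < n \<Longrightarrow> v < n \<Longrightarrow>
      {u, v} \<in> base_example n \<longleftrightarrow> {f u, f v} \<in> pendant_example n"
    by (auto simp: graph_iso_def)
  interpret B: clique_extension n "{2}" "{3..<n - h}"
    using assms by unfold_locales auto
  interpret P: clique_extension n "{2..<n - h}" "{}"
    using h by unfold_locales auto
  have "1 \<in> f ` {..<n}" using f assms by (simp add: bij_betw_def)
  then obtain a where a: "a < n" "f a = 1" by auto
  have unique: "u = v" if "{a, u} \<in> base_example n" "{a, v} \<in> base_example n" "u < n" "v < n" for u v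
  proof -
    have "f u = 0" "f v = 0"
      using iso a that by (auto simp: pendant_example_def P.edge_1 simp flip: h_def)
    then show ?thesis using f that by (auto simp: bij_betw_def inj_on_def)
  qed
  \<comment> \<open>In the first graph every vertex has two neighbours. For \<open>a = 1\<close> the
    second one is 3, in \<open>{3..<n - h}\<close> because \<open>h + 4 \<le> n\<close>.\<close>
  moreover have "\<exists>u<n. \<exists>v<n. u \<noteq> v \<and> {a, u} \<in> base_example n \<and> {a, v} \<in> base_example n"
  proof -
    consider "a = 0" | "a = 1" | "a = 2" | "a = 3" | "a \<ge> 4" by linarith
    then show ?thesis
    proof cases
      case 1 then show ?thesis using assms
        by (intro exI[of _ 1] exI[of _ 2] conjI) (simp_all add: base_example_def B.edge_0 flip: h_def)
    next
      case 2 then show ?thesis using assms h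
        by (intro exI[of _ 0] exI[of _ 3] conjI) (simp_all add: base_example_def B.edge_1 flip: h_def)
    next
      case 3 then show ?thesis using assms
        by (intro exI[of _ 3] exI[of _ 4] conjI) (simp_all add: base_example_def B.edge_clique flip: h_def)
    next
      case 4 then show ?thesis using assms
        by (intro exI[of _ 2] exI[of _ 4] conjI) (simp_all add: base_example_def B.edge_clique flip: h_def)
    next
      case 5 then show ?thesis using assms a
        by (intro exI[of _ 2] exI[of _ 3] conjI) (simp_all add: base_example_def B.edge_clique flip: h_def)
    qed
  qed
  ultimately show False by blast
qed

theorem mainTheorem2:
  shows "(\<forall>n::int. n \<ge> 8 \<longrightarrow>
            (\<exists>(V :: nat set) E. simple_graph V E \<and> int (card V) = n \<and>
               real (card E) = edge_threshold n \<and> has_nonpos_edge V E)) \<and>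
         (\<forall>n::int. n = 8 \<or> n = 10 \<or> (odd n \<and> n \<ge> 9) \<longrightarrow>
            (\<exists>(V1 :: nat set) E1 (V2 :: nat set) E2.
               simple_graph V1 E1 \<and> int (card V1) = n \<and>
               real (card E1) = edge_threshold n \<and> has_nonpos_edge V1 E1 \<and>
               simple_graph V2 E2 \<and> int (card V2) = n \<and>
               real (card E2) = edge_threshold n \<and> has_nonpos_edge V2 E2 \<and>
               \<not> graph_iso V1 E1 V2 E2))"
proof (intro conjI allI impI)
  fix n :: int assume "n \<ge> 8"
  then obtain m where m: "n = int m" "m \<ge> 8" by (cases n rule: int_cases2) auto
  then show "\<exists>(V :: nat set) E. simple_graph V E \<and> int (card V) = n \<and>
               real (card E) = edge_threshold n \<and> has_nonpos_edge V E"
    using base_example_extremal[OF m(2)]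
    by (intro exI[of _ "{..<m}"] exI[of _ "base_example m"]) (simp add: extremal_example_def)
next
  fix n :: int assume n: "n = 8 \<or> n = 10 \<or> (odd n \<and> n \<ge> 9)"
  define m where "m = nat n"
  have m: "n = int m" "m \<ge> 8" and cases: "m = 8 \<or> m = 10 \<or> odd m \<and> m \<ge> 9"
    using n by (auto simp: m_def even_nat_iff)
  \<comment> \<open>The partner of the base example is the pendant graph for 8 and 10 and the
    dominated graph for odd \<open>m\<close>.\<close>
  have "\<exists>E2. extremal_example m E2 \<and> \<not> graph_iso {..<m} (base_example m) {..<m} E2"
    using cases m(2) pendant_example_extremal dominated_example_extremal
      base_pendant_not_iso base_dominated_not_iso by metis
  then obtain E2 where "extremal_example m E2" "\<not> graph_iso {..<m} (base_example m) {..<m} E2"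
    by blast
  then show "\<exists>(V1 :: nat set) E1 (V2 :: nat set) E2.
               simple_graph V1 E1 \<and> int (card V1) = n \<and>
               real (card E1) = edge_threshold n \<and> has_nonpos_edge V1 E1 \<and>
               simple_graph V2 E2 \<and> int (card V2) = n \<and>
               real (card E2) = edge_threshold n \<and> has_nonpos_edge V2 E2 \<and>
               \<not> graph_iso V1 E1 V2 E2"
    using base_example_extremal[OF m(2)] m(1)
    by (intro exI[of _ "{..<m}"] exI[of _ "base_example m"] exI[of _ E2])
      (simp add: extremal_example_def)
qed

end
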